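(* (i) Let $S\equiv\pm\{1, 3, 4, 5, 7, 18, 21, 22, 23, 24, 25, 27\}\pmod{56}$ and $T\equiv\pm\{1, 2, 3, 7, 11, 17, 20, 21, 24, 25, 26, 27\}\pmod{56}$. Then $p(S,n)=p(T,n-1)$ for all $n\geq 1$. (ii) Let $S\equiv\pm\{2, 3, 7, 9, 10, 12, 13, 15, 16, 19, 21, 25\}\pmod{56}$ and $T\equiv\pm\{3, 4, 5, 6, 7, 9, 16, 19, 21, 22, 23, 25\}\pmod{56}$. Then $p(S,n)=p(T,n)$ for all integers $n\ge0$ with $n\neq 2$. (iii) Let $S\equiv\pm\{2, 3, 5, 7, 8, 13, 15, 20, 21, 22, 23, 25\}\pmod{56}$ and $T\equiv\pm\{1, 5, 7, 8, 10, 12, 13, 15, 18, 21, 23, 27\}\pmod{56}$. Then $p(S,n)=p(T,n)$ for all integers $n\ge0$ with $n\neq 1$. (iv) Let $S\equiv\pm\{1, 7, 8, 9, 10, 12, 13, 15, 18, 19, 21, 27\}\pmod{56}$ and $T\equiv\pm\{1, 6, 7, 8, 9, 11, 17, 19, 20, 21, 26, 27\}\pmod{56}$. Then $p(S,n)=p(T,n-1)$ for all $n\geq 1$. (v) Let $S\equiv\pm\{4, 5, 6, 7, 9, 11, 16, 17, 19, 21, 22, 23\}\pmod{56}$ and $T\equiv\pm\{1, 5, 7, 11, 12, 16, 17, 18, 21, 23, 26, 27\}\pmod{56}$. Then $p(S,n)=p(T,n-4)$ for all $n\geq 4$. (vi) Let $S\equiv\pm\{4, 6, 7, 9, 10, 11,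 13, 15, 17, 19, 21, 24\}\pmod{56}$ and $T\equiv\pm\{2, 3, 7, 11, 13, 15, 17, 20, 21, 24, 25, 26\}\pmod{56}$. Then $p(S,n)=p(T,n-4)$ for all $n\geq 4$.
   Context: For a set $S$ of positive integers and an integer $n\ge 0$, $p(S,n)$ denotes the number of partitions of $n$ into parts belonging to $S$ (so $p(S,0)=1$). The notation $S\equiv\pm\{r_1,\dots,r_k\}\pmod M$ means that $S$ is the set of all positive integers $n$ such that $n\equiv r_i$ or $n\equiv -r_i\pmod M$ for some $i$. *)

theory Defs
  imports Main "HOL-Library.Multiset" "HOL-Number_Theory.Cong"
begin

(* A partition is the multiset of its parts. S must not contain 0: otherwise the set
   counted below is infinite (or empty) and card gives 0. *)
definition num_partitions :: "nat set \<Rightarrow> nat \<Rightarrow> nat" where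
  "num_partitions S n = card {P :: nat multiset. set_mset P \<subseteq> S \<and> sum_mset P = n}"

definition pm_residues :: "int set \<Rightarrow> int \<Rightarrow> nat set" where
  "pm_residues R M = {n. n > 0 \<and> (\<exists>r\<in>R. [int n = r] (mod M) \<or> [int n = - r] (mod M))}"

end

theory Submission
  imports Defs "HOL-Analysis.Infinite_Sum" "HOL-Analysis.Infinite_Products" "HOL-Library.Nat_Bijection"
begin

text \<open>
  Write \<open>[r]\<close> for the product of all \<open>1 - q ^ n\<close> with \<open>n > 0\<close> congruent to \<open>r\<close> or \<open>- r\<close> modulo 56.
  The generating function of the partitions into parts from \<open>S\<close> is the inverse of a product of
  such factors, so each of the six claims says that two of these inverse products, one of them
  multiplied by a power of \<open>q\<close>, differ by a power of \<open>q\<close>. Each of these is a single instance of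
  Weierstrass' three-term relation for theta functions of nome \<open>q ^ 28\<close>, with the eight
  arguments of the outer terms of the form \<open>- (q ^ r)\<close> and the four of the middle term of the form
  \<open>q ^ r\<close>: by the Jacobi triple product, the theta values at \<open>q ^ r\<close> and \<open>- (q ^ r)\<close> are
  \<open>[r] [28 - r]\<close> and \<open>[2 r] / ([r] [28 - r])\<close> up to a common constant, and dividing the relation
  by the middle term turns the outer terms into the two generating functions. The three-term
  relation is a Pluecker relation, since the theta product at \<open>x y\<close> and \<open>x / y\<close> splits, by parity of
  the summation indices, as a two-by-two determinant in functions of \<open>x\<close> and of \<open>y\<close>.
\<close>

section \<open>Infinite products\<close>

definition qpoch :: "real \<Rightarrow> real \<Rightarrow> real" where
  "qpoch a p = (\<Prod>n. 1 - a * p ^ n)"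

lemma convergent_qpoch:
  fixes a p :: real
  assumes "\<bar>p\<bar> < 1"
  shows "convergent_prod (\<lambda>n. 1 - a * p ^ n)"
proof (rule abs_convergent_prod_imp_convergent_prod)
  have "summable (\<lambda>n. norm (a * p ^ n))"
    using assms by (simp add: abs_mult power_abs summable_mult)
  then show "abs_convergent_prod (\<lambda>n. 1 - a * p ^ n)"
    unfolding abs_convergent_prod_conv_summable by simp
qed

lemma qpoch_LIMSEQ:
  assumes "\<bar>p\<bar> < 1"
  shows "(\<lambda>N. \<Prod>n<N. 1 - a * p ^ n) \<longlonglongrightarrow> qpoch a p"
  using has_prod_imp_tendsto'[OF convergent_prod_has_prod[OF convergent_qpoch[OF assms]]]
  by (simp add: qpoch_def)

lemma qpoch_pos:
  assumes "0 \<le> p" "p < 1" "a < 1"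
  shows "qpoch a p > 0"
proof -
  have "a * p ^ n < 1" for n
  proof -
    have "a * p ^ n \<le> max a 0 * 1"
      using assms by (intro mult_mono) (auto simp: power_le_one)
    also have "\<dots> < 1" using assms by simp
    finally show ?thesis .
  qed
  then show ?thesis
    using less_0_prodinf[OF convergent_qpoch, of p a] assms by (auto simp: qpoch_def)
qed

lemma qpoch_mult_uminus:
  assumes "\<bar>p\<bar> < 1"
  shows "qpoch a p * qpoch (- a) p = qpoch (a\<^sup>2) (p\<^sup>2)"
proof -
  have "1 - a\<^sup>2 * (p\<^sup>2) ^ n = (1 - a * p ^ n) * (1 - (- a) * p ^ n)" for n
    by (simp add: algebra_simps power2_eq_square power_mult_distrib)
  then show ?thesis
    unfolding qpoch_def by (simp only: prodinf_mult[OF convergent_qpoch convergent_qpoch] assms)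
qed

lemma qpoch_split:
  assumes "\<bar>p\<bar> < 1"
  shows "qpoch a p = qpoch a (p\<^sup>2) * qpoch (a * p) (p\<^sup>2)"
proof -
  have p2: "\<bar>p\<^sup>2\<bar> < 1" using assms by (simp add: abs_square_less_1)
  have eq: "(\<Prod>n<2 * N. 1 - a * p ^ n) =
      (\<Prod>n<N. 1 - a * (p\<^sup>2) ^ n) * (\<Prod>n<N. 1 - a * p * (p\<^sup>2) ^ n)" for N
    by (induction N) (simp_all add: power_mult[symmetric] power_add algebra_simps)
  have "(\<lambda>N. \<Prod>n<2 * N. 1 - a * p ^ n) \<longlonglongrightarrow> qpoch a p"
    by (rule filterlim_compose[OF qpoch_LIMSEQ[OF assms]])
       (auto intro!: filterlim_subseq simp: strict_mono_def)
  moreover have "(\<lambda>N. \<Prod>n<2 * N. 1 - a * p ^ n) \<longlonglongrightarrow>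
      qpoch a (p\<^sup>2) * qpoch (a * p) (p\<^sup>2)"
    unfolding eq by (intro tendsto_mult qpoch_LIMSEQ p2)
  ultimately show ?thesis by (rule LIMSEQ_unique)
qed

section \<open>Theta series and the three-term relation\<close>

lemma has_sum_mult_Times:
  fixes f :: "'a \<Rightarrow> real" and g :: "'b \<Rightarrow> real"
  assumes "f summable_on A" "g summable_on B"
  shows "((\<lambda>(x, y). f x * g y) has_sum (infsum f A * infsum g B)) (A \<times> B)"
proof (rule has_sum_SigmaI)
  have fa: "f abs_summable_on A" and ga: "g abs_summable_on B"
    using assms summable_on_iff_abs_summable_on_real by auto
  show "((\<lambda>y. (case (x, y) of (x, y) \<Rightarrow> f x * g y)) has_sum (f x * infsum g B)) B" for x
    using assms(2) by (simp add: has_sum_cmult_right)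
  show "((\<lambda>x. f x * infsum g B) has_sum (infsum f A * infsum g B)) A"
    using assms(1) by (simp add: has_sum_cmult_left)
  show "(\<lambda>(x, y). f x * g y) summable_on A \<times> B"
  proof -
    have "(\<lambda>(x, y). f x * g y) abs_summable_on A \<times> B"
      unfolding abs_summable_on_Sigma_iff
      using fa ga by (auto simp: abs_mult infsum_cmult_right' intro!: summable_on_cmult_left summable_on_cmult_right)
    then show ?thesis by (rule abs_summable_summable)
  qed
qed

definition theta :: "real \<Rightarrow> real \<Rightarrow> real" where
  "theta Q x = (\<Sum>\<^sub>\<infinity>n::int. Q powi (n * n) * x powi n)"

lemma summable_square_exponent:
  fixes Q x :: real
  assumes "0 < Q" "Q < 1"
  shows "summable (\<lambda>n. norm (Q ^ (n * n) * x ^ n))"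
proof (rule summable_comparison_test_ev)
  have "(\<lambda>n. Q ^ n * \<bar>x\<bar>) \<longlonglongrightarrow> 0 * \<bar>x\<bar>"
    using assms by (intro tendsto_mult LIMSEQ_realpow_zero tendsto_const) auto
  then have "eventually (\<lambda>n. Q ^ n * \<bar>x\<bar> < 1 / 2) sequentially"
    by (rule order_tendstoD) auto
  then show "eventually (\<lambda>n. norm (norm (Q ^ (n * n) * x ^ n)) \<le> (1 / 2) ^ n) sequentially"
  proof eventually_elim
    case (elim n)
    have "norm (norm (Q ^ (n * n) * x ^ n)) = (Q ^ n * \<bar>x\<bar>) ^ n"
      using assms by (simp add: abs_mult power_abs power_mult power_mult_distrib)
    also have "\<dots> \<le> (1 / 2) ^ n"
      using elim assms by (intro power_mono) auto
    finally show ?case .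
  qed
qed (simp add: summable_geometric)

lemma theta_summable:
  fixes Q x :: real
  assumes "0 < Q" "Q < 1"
  shows "(\<lambda>n::int. Q powi (n * n) * x powi n) summable_on UNIV"
proof -
  let ?f = "\<lambda>n::int. Q powi (n * n) * x powi n"
  note summable = norm_summable_imp_summable_on[OF summable_square_exponent[OF assms]]
  have "?f summable_on range int"
    by (subst summable_on_reindex)
       (use summable[of x] in \<open>auto simp: o_def simp flip: of_nat_mult\<close>)
  moreover have "?f summable_on range (\<lambda>n. - int n)"
  proof (subst summable_on_reindex)
    have "(?f \<circ> (\<lambda>n. - int n)) = (\<lambda>n. Q ^ (n * n) * (inverse x) ^ n)"
      by (auto simp: fun_eq_iff power_int_minus power_inverse simp flip: of_nat_mult)
    then show "(?f \<circ> (\<lambda>n. - int n)) summable_on UNIV"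
      using summable[of "inverse x"] by simp
  qed (auto intro: injI)
  ultimately have "?f summable_on (range int \<union> range (\<lambda>n. - int n))"
    by (rule summable_on_union)
  moreover have "range int \<union> range (\<lambda>n. - int n) = UNIV"
  proof -
    have "m \<in> range int \<union> range (\<lambda>n. - int n)" for m :: int
      by (cases m rule: int_cases2) auto
    then show ?thesis by auto
  qed
  ultimately show ?thesis by simp
qed

lemma theta_has_sum:
  assumes "0 < Q" "Q < 1"
  shows "((\<lambda>n::int. Q powi (n * n) * x powi n) has_sum theta Q x) UNIV"
  using theta_summable[OF assms] by (simp add: theta_def)

lemma theta_quasi_period:
  assumes "0 < Q" "Q < 1" "x \<noteq> 0"
  shows "theta Q x = Q * x * theta Q (Q\<^sup>2 * x)"
proof -
  have "((\<lambda>n. Q * x * (Q powi (n * n) * (Q\<^sup>2 * x) powi n)) has_sum Q * x * theta Q (Q\<^sup>2 * x)) UNIV"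
    by (intro has_sum_cmult_right theta_has_sum assms)
  also have "(\<lambda>n. Q * x * (Q powi (n * n) * (Q\<^sup>2 * x) powi n)) =
      (\<lambda>n. Q powi ((n + 1) * (n + 1)) * x powi (n + 1))"
  proof
    fix n :: int
    have "Q powi ((n + 1) * (n + 1)) = Q powi (n * n) * Q powi (2 * n) * Q"
      using assms by (simp add: algebra_simps power_int_add)
    then show "Q * x * (Q powi (n * n) * (Q\<^sup>2 * x) powi n) =
        Q powi ((n + 1) * (n + 1)) * x powi (n + 1)"
      using assms by (simp add: power_int_add power_int_mult_distrib power_int_mult)
  qed
  finally have "((\<lambda>n::int. Q powi (n * n) * x powi n) has_sum Q * x * theta Q (Q\<^sup>2 * x)) UNIV"
    by (subst (asm) has_sum_reindex_bij_betw[of "\<lambda>n. n + 1" UNIV UNIV "\<lambda>n. Q powi (n * n) * x powi n"])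
       (auto intro: bij_betwI[of _ _ _ "\<lambda>n. n - 1"])
  with theta_has_sum[OF assms(1,2), of x] show ?thesis
    by (rule has_sum_unique)
qed

lemma theta_mult_theta:
  assumes Q: "0 < Q" "Q < 1" and xy: "x \<noteq> 0" "y \<noteq> 0"
  shows "theta Q x * theta Q y = theta (Q\<^sup>2) (x * y) * theta (Q\<^sup>2) (x / y) +
           Q * x * (theta (Q\<^sup>2) (Q\<^sup>2 * (x * y)) * theta (Q\<^sup>2) (Q\<^sup>2 * (x / y)))"
proof -
  define f where "f = (\<lambda>(m::int, n::int). (Q powi (m * m) * x powi m) * (Q powi (n * n) * y powi n))"
  have Q2: "0 < Q\<^sup>2" "Q\<^sup>2 < 1" using Q by (auto simp: power_less_one_iff)
  have [simp]: "Q \<noteq> 0" using Q by simp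
  have times: "((\<lambda>(m::int, n::int). (P powi (m * m) * a powi m) * (P powi (n * n) * b powi n)) has_sum
      theta P a * theta P b) (UNIV \<times> UNIV)" if "0 < P" "P < 1" for P a b :: real
    unfolding theta_def by (intro has_sum_mult_Times theta_summable that)
  have all: "(f has_sum theta Q x * theta Q y) UNIV"
    using times[OF Q, of x y] by (simp add: f_def)
  have "(f has_sum theta (Q\<^sup>2) (x * y) * theta (Q\<^sup>2) (x / y)) {(m, n). even (m + n)}"
  proof (subst has_sum_reindex_bij_witness[symmetric, where
        j = "\<lambda>(r::int, s::int). (r + s, r - s)" and i = "\<lambda>(m, n). ((m + n) div 2, (m - n) div 2)"])
    show "((\<lambda>(m::int, n::int). ((Q\<^sup>2) powi (m * m) * (x * y) powi m) * ((Q\<^sup>2) powi (n * n) * (x / y) powi n))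
        has_sum theta (Q\<^sup>2) (x * y) * theta (Q\<^sup>2) (x / y)) (UNIV \<times> UNIV)"
      by (rule times[OF Q2])
    show "f (case a of (r, s) \<Rightarrow> (r + s, r - s)) = (case a of (r, s) \<Rightarrow>
        ((Q\<^sup>2) powi (r * r) * (x * y) powi r) * ((Q\<^sup>2) powi (s * s) * (x / y) powi s))" for a
    proof (cases a)
      case (Pair r s)
      have "Q powi ((r + s) * (r + s)) * Q powi ((r - s) * (r - s)) = (Q\<^sup>2) powi (r * r) * (Q\<^sup>2) powi (s * s)"
        by (simp add: power_int_power algebra_simps flip: power_int_add)
      moreover have "x powi (r + s) * y powi (r - s) = (x * y) powi r * (x / y) powi s"
        using xy by (simp add: power_int_add power_int_diff power_int_mult_distrib power_int_divide_distrib)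
      ultimately show ?thesis
        by (simp add: f_def Pair mult_ac)
    qed
  qed (auto, presburger+)
  moreover have "(f has_sum Q * x * (theta (Q\<^sup>2) (Q\<^sup>2 * (x * y)) * theta (Q\<^sup>2) (Q\<^sup>2 * (x / y))))
      {(m, n). odd (m + n)}"
  proof (subst has_sum_reindex_bij_witness[symmetric, where
        j = "\<lambda>(r::int, s::int). (r + s + 1, r - s)" and i = "\<lambda>(m, n). ((m + n) div 2, (m - n) div 2)"])
    show "((\<lambda>a. Q * x * (case a of (m::int, n::int) \<Rightarrow>
          ((Q\<^sup>2) powi (m * m) * (Q\<^sup>2 * (x * y)) powi m) * ((Q\<^sup>2) powi (n * n) * (Q\<^sup>2 * (x / y)) powi n)))
        has_sum Q * x * (theta (Q\<^sup>2) (Q\<^sup>2 * (x * y)) * theta (Q\<^sup>2) (Q\<^sup>2 * (x / y)))) (UNIV \<times> UNIV)"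
      by (intro has_sum_cmult_right times[OF Q2])
    show "f (case a of (r, s) \<Rightarrow> (r + s + 1, r - s)) = Q * x * (case a of (r, s) \<Rightarrow>
          ((Q\<^sup>2) powi (r * r) * (Q\<^sup>2 * (x * y)) powi r) * ((Q\<^sup>2) powi (s * s) * (Q\<^sup>2 * (x / y)) powi s))" for a
    proof (cases a)
      case (Pair r s)
      have "Q powi ((r + s + 1) * (r + s + 1)) * Q powi ((r - s) * (r - s)) =
          Q powi (2 * (r * r) + 2 * r + (2 * (s * s) + 2 * s) + 1)"
        by (simp add: algebra_simps flip: power_int_add)
      also have "\<dots> = Q * (((Q\<^sup>2) powi (r * r) * (Q\<^sup>2) powi r) * ((Q\<^sup>2) powi (s * s) * (Q\<^sup>2) powi s))"
        by (simp add: power_int_power power_int_add)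
      finally have 1: "Q powi ((r + s + 1) * (r + s + 1)) * Q powi ((r - s) * (r - s)) = \<dots>" .
      have 2: "x powi (r + s + 1) * y powi (r - s) = x * ((x * y) powi r * (x / y) powi s)"
        using xy by (simp add: power_int_add power_int_diff power_int_mult_distrib power_int_divide_distrib)
      have "f (r + s + 1, r - s) = (Q powi ((r + s + 1) * (r + s + 1)) * Q powi ((r - s) * (r - s))) *
          (x powi (r + s + 1) * y powi (r - s))"
        unfolding f_def by (simp only: prod.case mult_ac)
      also have "\<dots> = Q * x * (((Q\<^sup>2) powi (r * r) * (Q\<^sup>2 * (x * y)) powi r) *
          ((Q\<^sup>2) powi (s * s) * (Q\<^sup>2 * (x / y)) powi s))"
        unfolding 1 2 power_int_mult_distrib[of "Q\<^sup>2"] by (simp only: mult_ac)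
      finally show ?thesis by (simp only: Pair prod.case)
    qed
  qed (auto, presburger+)
  ultimately have "(f has_sum (theta (Q\<^sup>2) (x * y) * theta (Q\<^sup>2) (x / y) +
      Q * x * (theta (Q\<^sup>2) (Q\<^sup>2 * (x * y)) * theta (Q\<^sup>2) (Q\<^sup>2 * (x / y)))))
      ({(m, n). even (m + n)} \<union> {(m, n). odd (m + n)})"
    by (rule has_sum_Un_disjoint) auto
  also have "{(m, n). even (m + n)} \<union> {(m, n). odd (m + n)} = (UNIV :: (int \<times> int) set)"
    by auto
  finally show ?thesis using all has_sum_unique by blast
qed

definition jtheta :: "real \<Rightarrow> real \<Rightarrow> real" where
  "jtheta Q x = theta Q (- x / Q)"

lemma jtheta_mult_jtheta:
  assumes Q: "0 < Q" "Q < 1" and xy: "x \<noteq> 0" "y \<noteq> 0"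
  defines "g \<equiv> \<lambda>x. theta (Q\<^sup>2) (x\<^sup>2)" and "h \<equiv> \<lambda>x. x * theta (Q\<^sup>2) (Q\<^sup>2 * x\<^sup>2)"
  shows "jtheta Q (x * y) * jtheta Q (x / y) = x * (h x * g y - g x * h y)"
proof -
  have Q2: "0 < Q\<^sup>2" "Q\<^sup>2 < 1" using Q by (auto simp: power_less_one_iff)
  have "jtheta Q (x * y) * jtheta Q (x / y) = theta (Q\<^sup>2) (x\<^sup>2 / Q\<^sup>2) * theta (Q\<^sup>2) (y\<^sup>2) -
      x * y * (theta (Q\<^sup>2) (x\<^sup>2) * theta (Q\<^sup>2) (Q\<^sup>2 * y\<^sup>2))"
    unfolding jtheta_def using theta_mult_theta[OF Q, of "- (x * y) / Q" "- (x / y) / Q"] Q xy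
    by (simp add: power2_eq_square)
  also have "theta (Q\<^sup>2) (x\<^sup>2 / Q\<^sup>2) = x\<^sup>2 * theta (Q\<^sup>2) (Q\<^sup>2 * x\<^sup>2)"
    using theta_quasi_period[OF Q2, of "x\<^sup>2 / Q\<^sup>2"] Q xy by (simp add: power2_eq_square mult.assoc)
  finally show ?thesis
    by (simp add: g_def h_def power2_eq_square algebra_simps)
qed

theorem weierstrass_three_term:
  assumes "0 < Q" "Q < 1" and "x \<noteq> 0" "y \<noteq> 0" "u \<noteq> 0" "v \<noteq> 0"
  shows "jtheta Q (x * y) * jtheta Q (x / y) * (jtheta Q (u * v) * jtheta Q (u / v)) -
         jtheta Q (x * v) * jtheta Q (x / v) * (jtheta Q (u * y) * jtheta Q (u / y)) =
         u / y * (jtheta Q (y * v) * jtheta Q (y / v) * (jtheta Q (x * u) * jtheta Q (x / u)))"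
proof -
  define g h where "g = (\<lambda>x. theta (Q\<^sup>2) (x\<^sup>2))" and "h = (\<lambda>x. x * theta (Q\<^sup>2) (Q\<^sup>2 * x\<^sup>2))"
  have *: "jtheta Q (a * b) * jtheta Q (a / b) = a * (h a * g b - g a * h b)"
    if "a \<noteq> 0" "b \<noteq> 0" for a b
    using jtheta_mult_jtheta[OF assms(1,2) that] by (simp add: g_def h_def)
  show ?thesis
    unfolding *[OF assms(3,4)] *[OF assms(5,6)] *[OF assms(3,6)] *[OF assms(5,4)]
      *[OF assms(4,6)] *[OF assms(3,5)]
    using assms(4) by (simp add: algebra_simps)
qed

lemma jtheta_inverse:
  assumes Q: "0 < Q" "Q < 1" and "x \<noteq> 0"
  shows "jtheta Q (1 / x) = - jtheta Q x / x"
proof -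
  have inv: "theta Q (1 / y) = theta Q y" for y
    unfolding theta_def
    by (rule infsum_reindex_bij_witness[of _ uminus uminus])
       (auto simp: power_int_minus power_int_divide_distrib field_simps)
  have "jtheta Q (1 / x) = theta Q (- (Q * x))"
    using inv[of "- (Q * x)"] by (simp add: jtheta_def mult.commute)
  moreover have "jtheta Q x = - x * theta Q (- (Q * x))"
    using theta_quasi_period[OF Q, of "- x / Q"] assms by (simp add: jtheta_def power2_eq_square)
  ultimately show ?thesis using assms by simp
qed

section \<open>The Jacobi triple product\<close>

fun gauss_binom :: "real \<Rightarrow> nat \<Rightarrow> nat \<Rightarrow> real" where
  "gauss_binom p M 0 = 1"
| "gauss_binom p 0 (Suc k) = 0"
| "gauss_binom p (Suc M) (Suc k) = gauss_binom p M (Suc k) + p ^ (M - k) * gauss_binom p M k"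

lemma gauss_binom_eq_0: "M < k \<Longrightarrow> gauss_binom p M k = 0"
  by (induction p M k rule: gauss_binom.induct) auto

lemma gauss_binom_self: "gauss_binom p k k = 1"
  by (induction k) (simp_all add: gauss_binom_eq_0)

lemma gauss_binom_nonneg: "0 \<le> p \<Longrightarrow> 0 \<le> gauss_binom p M k"
  by (induction p M k rule: gauss_binom.induct) auto

abbreviation fin_qpoch :: "real \<Rightarrow> nat \<Rightarrow> real" where
  "fin_qpoch p N \<equiv> (\<Prod>n<N. 1 - p * p ^ n)"

lemma gauss_binom_fin_qpoch:
  "gauss_binom p (k + m) k * (fin_qpoch p k * fin_qpoch p m) = fin_qpoch p (k + m)"
proof (induction "k + m" arbitrary: k m)
  case (Suc M)
  show ?case
  proof (cases k)
    case k: (Suc k')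
    show ?thesis
    proof (cases m)
      case 0
      then show ?thesis by (simp add: gauss_binom_self)
    next
      case m: (Suc m')
      have M: "M = Suc k' + m'" "M = k' + Suc m'" using Suc(2) k m by auto
      have "gauss_binom p (Suc M) (Suc k') * (fin_qpoch p (Suc k') * fin_qpoch p (Suc m')) =
          gauss_binom p M (Suc k') * (fin_qpoch p (Suc k') * fin_qpoch p m') * (1 - p * p ^ m') +
          p ^ Suc m' * (1 - p * p ^ k') * (gauss_binom p M k' * (fin_qpoch p k' * fin_qpoch p (Suc m')))"
        using M(2) by (simp add: algebra_simps)
      also have "\<dots> = fin_qpoch p M * (1 - p * p ^ m') + p ^ Suc m' * (1 - p * p ^ k') * fin_qpoch p M"
        using Suc(1)[OF M(1)] Suc(1)[OF M(2)] M by simp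
      also have "\<dots> = fin_qpoch p (Suc M)"
        using M by (simp add: algebra_simps power_add)
      finally show ?thesis using M k m by simp
    qed
  qed simp
qed simp

lemma gauss_binomial_theorem:
  fixes Q y :: real
  shows "(\<Prod>j<M. 1 + y * Q ^ (2 * j + 1)) = (\<Sum>k\<le>M. gauss_binom (Q\<^sup>2) M k * Q ^ (k * k) * y ^ k)"
proof (induction M)
  case (Suc M)
  let ?b = "gauss_binom (Q\<^sup>2)"
  have "?b M k * Q ^ (k * k) * y ^ k * (y * Q ^ (2 * M + 1)) =
      (Q\<^sup>2) ^ (M - k) * ?b M k * Q ^ (Suc k * Suc k) * y ^ Suc k" if "k \<le> M" for k
  proof -
    have "Q ^ (k * k) * Q ^ (2 * M + 1) = (Q\<^sup>2) ^ (M - k) * Q ^ (Suc k * Suc k)"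
      unfolding power_mult[symmetric] power_add[symmetric]
      using that by (intro arg_cong[of _ _ "power Q"]) (simp add: diff_mult_distrib2)
    then show ?thesis by (simp add: mult_ac) (metis mult.left_commute)
  qed
  then have "(\<Sum>k\<le>M. ?b M k * Q ^ (k * k) * y ^ k) * (y * Q ^ (2 * M + 1)) =
      (\<Sum>k\<le>M. (Q\<^sup>2) ^ (M - k) * ?b M k * Q ^ (Suc k * Suc k) * y ^ Suc k)"
    unfolding sum_distrib_right by (intro sum.cong) auto
  moreover have "(\<Sum>k\<le>M. ?b M k * Q ^ (k * k) * y ^ k) =
      1 + (\<Sum>k\<le>M. ?b M (Suc k) * Q ^ (Suc k * Suc k) * y ^ Suc k)"
    using sum.atMost_Suc[of "\<lambda>k. ?b M k * Q ^ (k * k) * y ^ k" M]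
      sum.atMost_Suc_shift[of "\<lambda>k. ?b M k * Q ^ (k * k) * y ^ k" M]
    by (simp add: gauss_binom_eq_0)
  ultimately have "(\<Sum>k\<le>M. ?b M k * Q ^ (k * k) * y ^ k) * (1 + y * Q ^ (2 * M + 1)) =
      1 + (\<Sum>k\<le>M. ?b M (Suc k) * Q ^ (Suc k * Suc k) * y ^ Suc k) +
      (\<Sum>k\<le>M. (Q\<^sup>2) ^ (M - k) * ?b M k * Q ^ (Suc k * Suc k) * y ^ Suc k)"
    by (simp only: distrib_left mult_1_right)
  also have "\<dots> = 1 + (\<Sum>k\<le>M. ?b (Suc M) (Suc k) * Q ^ (Suc k * Suc k) * y ^ Suc k)"
    by (simp add: sum.distrib distrib_right)
  also have "\<dots> = (\<Sum>k\<le>Suc M. ?b (Suc M) k * Q ^ (k * k) * y ^ k)"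
    by (subst sum.atMost_Suc_shift) simp
  finally show ?case using Suc.IH by simp
qed simp

lemma finite_jacobi_triple_product:
  assumes "0 < Q" "x \<noteq> 0"
  shows "(\<Prod>j<N. (1 + x * Q ^ (2 * j + 1)) * (1 + Q ^ (2 * j + 1) / x)) =
    (\<Sum>n\<in>{- int N..int N}. gauss_binom (Q\<^sup>2) (2 * N) (nat (int N + n)) * (Q powi (n * n) * x powi n))"
proof -
  have [simp]: "Q \<noteq> 0" using assms by simp
  define y where "y = x / Q ^ (2 * N)"
  define c where "c = Q ^ (N * N) / x ^ N"
  have split: "c * (\<Prod>j<2 * N. 1 + y * Q ^ (2 * j + 1)) =
      (\<Prod>j<N. (1 + x * Q ^ (2 * j + 1)) * (1 + Q ^ (2 * j + 1) / x))"
  proof -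
    have "(\<Prod>j<2 * N. 1 + y * Q ^ (2 * j + 1)) =
        (\<Prod>j<N. 1 + y * Q ^ (2 * j + 1)) * (\<Prod>j<N. 1 + y * Q ^ (2 * (N + j) + 1))"
      using prod.atLeastLessThan_concat[of 0 N "2 * N" "\<lambda>j. 1 + y * Q ^ (2 * j + 1)"]
        prod.shift_bounds_nat_ivl[of "\<lambda>j. 1 + y * Q ^ (2 * j + 1)" 0 N N]
      by (simp add: mult_2 atLeast0LessThan add.commute)
    also have "(\<Prod>j<N. 1 + y * Q ^ (2 * (N + j) + 1)) = (\<Prod>j<N. 1 + x * Q ^ (2 * j + 1))"
      by (simp add: y_def power_add algebra_simps)
    also have "(\<Prod>j<N. 1 + y * Q ^ (2 * j + 1)) = (\<Prod>j<N. 1 + y * Q ^ (2 * (N - Suc j) + 1))"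
      by (rule prod.nat_diff_reindex[symmetric])
    also have "\<dots> = (\<Prod>j<N. x / Q ^ (2 * j + 1) * (1 + Q ^ (2 * j + 1) / x))"
    proof (intro prod.cong refl)
      fix j assume "j \<in> {..<N}"
      then have "Q ^ (2 * N) = Q ^ (2 * (N - Suc j) + 1) * Q ^ (2 * j + 1)"
        unfolding power_add[symmetric] by (intro arg_cong[of _ _ "power Q"]) auto
      then show "1 + y * Q ^ (2 * (N - Suc j) + 1) = x / Q ^ (2 * j + 1) * (1 + Q ^ (2 * j + 1) / x)"
        using assms by (simp add: y_def field_simps)
    qed
    also have "\<dots> = (\<Prod>j<N. x / Q ^ (2 * j + 1)) * (\<Prod>j<N. 1 + Q ^ (2 * j + 1) / x)"
      by (rule prod.distrib)
    also have "(\<Prod>j<N. x / Q ^ (2 * j + 1)) = x ^ N / Q ^ (N * N)"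
      by (induction N) (simp_all add: power_add mult_2 mult_2_right algebra_simps)
    finally show ?thesis
      using assms by (simp add: c_def prod.distrib mult_ac)
  qed
  have "c * (\<Prod>j<2 * N. 1 + y * Q ^ (2 * j + 1)) =
      (\<Sum>k\<le>2 * N. c * (gauss_binom (Q\<^sup>2) (2 * N) k * Q ^ (k * k) * y ^ k))"
    by (simp only: gauss_binomial_theorem sum_distrib_left)
  also have "\<dots> = (\<Sum>n\<in>{- int N..int N}. gauss_binom (Q\<^sup>2) (2 * N) (nat (int N + n)) * (Q powi (n * n) * x powi n))"
  proof (rule sum.reindex_bij_witness[of _ "\<lambda>n. nat (int N + n)" "\<lambda>k. int k - int N"])
    fix k assume "k \<in> {..2 * N}"
    have "c * Q ^ (k * k) * y ^ k = Q powi (int (N * N) + int (k * k) - int (2 * N * k)) * x powi (int k - int N)"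
    proof -
      have "Q powi (int (N * N) + int (k * k) - int (2 * N * k)) = Q ^ (N * N) * Q ^ (k * k) / Q ^ (2 * N * k)"
        by (subst power_int_diff, simp, subst power_int_add, simp, simp only: power_int_of_nat)
      moreover have "x powi (int k - int N) = x ^ k / x ^ N"
        using assms by (simp add: power_int_diff)
      ultimately show ?thesis
        by (simp add: c_def y_def power_divide power_mult)
    qed
    also have "int (N * N) + int (k * k) - int (2 * N * k) = (int k - int N) * (int k - int N)"
      by (simp add: algebra_simps)
    finally have "c * Q ^ (k * k) * y ^ k = Q powi ((int k - int N) * (int k - int N)) * x powi (int k - int N)" .
    then show "gauss_binom (Q\<^sup>2) (2 * N) (nat (int N + (int k - int N))) *
        (Q powi ((int k - int N) * (int k - int N)) * x powi (int k - int N)) =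
        c * (gauss_binom (Q\<^sup>2) (2 * N) k * Q ^ (k * k) * y ^ k)"
      by (simp add: mult_ac)
  qed auto
  finally show ?thesis using split by simp
qed

lemma fin_qpoch_bounds:
  assumes "0 < p" "p < 1"
  shows "0 < qpoch p p" "qpoch p p \<le> fin_qpoch p N" "fin_qpoch p N \<le> 1"
proof -
  show "0 < qpoch p p" using assms by (intro qpoch_pos) auto
  have factor: "0 \<le> 1 - p * p ^ n \<and> 1 - p * p ^ n \<le> 1" for n
    using assms power_le_one[of p "Suc n"] by auto
  have "decseq (fin_qpoch p)"
  proof (rule decseq_SucI)
    fix n
    have "0 \<le> fin_qpoch p n" using factor by (intro prod_nonneg) auto
    then show "fin_qpoch p (Suc n) \<le> fin_qpoch p n"
      using factor[of n] by (simp add: mult_left_le)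
  qed
  then show "qpoch p p \<le> fin_qpoch p N"
    using qpoch_LIMSEQ[of p p] assms by (intro decseq_ge) auto
  show "fin_qpoch p N \<le> 1"
    using factor by (intro prod_le_1) auto
qed

lemma gauss_binom_central:
  assumes p: "0 < p" "p < 1" and n: "- int N \<le> n" "n \<le> int N"
  shows "gauss_binom p (2 * N) (nat (int N + n)) =
    fin_qpoch p (2 * N) / (fin_qpoch p (nat (int N + n)) * fin_qpoch p (nat (int N - n)))"
proof -
  have "nat (int N + n) + nat (int N - n) = 2 * N" using n by linarith
  then have "gauss_binom p (2 * N) (nat (int N + n)) *
      (fin_qpoch p (nat (int N + n)) * fin_qpoch p (nat (int N - n))) = fin_qpoch p (2 * N)"
    using gauss_binom_fin_qpoch[of p "nat (int N + n)" "nat (int N - n)"] by simp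
  moreover have "fin_qpoch p m > 0" for m
    using fin_qpoch_bounds[OF p] by (meson less_le_trans)
  ultimately show ?thesis
    by (metis less_numeral_extra(3) mult_eq_0_iff nonzero_eq_divide_eq)
qed

theorem jacobi_triple_product:
  assumes Q: "0 < Q" "Q < 1" and x: "x \<noteq> 0"
  shows "theta Q x = qpoch (Q\<^sup>2) (Q\<^sup>2) * (qpoch (- (x * Q)) (Q\<^sup>2) * qpoch (- (Q / x)) (Q\<^sup>2))"
proof -
  define p where "p = Q\<^sup>2"
  have p: "0 < p" "p < 1" using Q by (auto simp: p_def power_less_one_iff)
  define L where "L = qpoch p p"
  have L: "0 < L" using fin_qpoch_bounds[OF p] by (simp add: L_def)
  have fin_ge: "L \<le> fin_qpoch p m" for m
    using fin_qpoch_bounds[OF p] by (simp add: L_def)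
  have fin_lim: "fin_qpoch p \<longlonglongrightarrow> L"
    using qpoch_LIMSEQ[of p p] p by (simp add: L_def)
  define t where "t = (\<lambda>n::int. Q powi (n * n) * x powi n)"
  define C where "C = (\<lambda>N (n::int). if n \<in> {- int N..int N} then gauss_binom p (2 * N) (nat (int N + n)) else 0)"
  have C_bound: "norm (C N n) \<le> 1 / (L * L)" for N n
  proof (cases "n \<in> {- int N..int N}")
    case True
    have "fin_qpoch p (2 * N) / (fin_qpoch p (nat (int N + n)) * fin_qpoch p (nat (int N - n))) \<le> 1 / (L * L)"
      using L fin_qpoch_bounds(3)[OF p] order.trans[OF less_imp_le[OF L] fin_ge]
      by (intro frac_le mult_mono fin_ge) auto
    then have "gauss_binom p (2 * N) (nat (int N + n)) \<le> 1 / (L * L)"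
      using True gauss_binom_central[OF p, of N n] by simp
    then show ?thesis
      using True gauss_binom_nonneg[of p] p by (simp add: C_def)
  qed (use L in \<open>auto simp: C_def\<close>)
  have C_lim: "(\<lambda>N. C N n) \<longlonglongrightarrow> 1 / L" for n
  proof -
    have shift: "(\<lambda>N. fin_qpoch p (nat (int N + m))) \<longlonglongrightarrow> L" for m
    proof (rule filterlim_compose[OF fin_lim])
      show "filterlim (\<lambda>N. nat (int N + m)) at_top sequentially"
        unfolding filterlim_at_top
      proof
        show "eventually (\<lambda>N. Z \<le> nat (int N + m)) sequentially" for Z
          by (rule eventually_sequentiallyI[of "Z + nat \<bar>m\<bar>"]) linarith
      qed
    qed
    have "(\<lambda>N. fin_qpoch p (2 * N)) \<longlonglongrightarrow> L"
      by (rule filterlim_compose[OF fin_lim]) (auto intro!: filterlim_subseq simp: strict_mono_def)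
    then have "(\<lambda>N. fin_qpoch p (2 * N) / (fin_qpoch p (nat (int N + n)) * fin_qpoch p (nat (int N + (- n)))))
        \<longlonglongrightarrow> L / (L * L)"
      using L by (intro tendsto_divide tendsto_mult shift) auto
    moreover have "eventually (\<lambda>N. fin_qpoch p (2 * N) / (fin_qpoch p (nat (int N + n)) *
        fin_qpoch p (nat (int N + (- n)))) = C N n) sequentially"
      by (intro eventually_sequentiallyI[of "nat \<bar>n\<bar>"]) (auto simp: C_def gauss_binom_central[OF p])
    ultimately have "(\<lambda>N. C N n) \<longlonglongrightarrow> L / (L * L)"
      by (rule Lim_transform_eventually)
    then show ?thesis using L by simp
  qed
  have t_abs: "(\<lambda>k. norm (t (int_decode k))) summable_on UNIV"
  proof -
    have "t summable_on UNIV" using theta_summable[OF Q] by (simp add: t_def)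
    then have "(\<lambda>n. norm (t n)) summable_on UNIV" by (rule iffD1[OF summable_on_iff_abs_summable_on_real])
    then show ?thesis
      by (subst summable_on_reindex_bij_betw[OF bij_int_decode])
  qed
  have "((\<lambda>N. \<Sum>k. C N (int_decode k) * t (int_decode k)) \<longlonglongrightarrow> (\<Sum>k. 1 / L * t (int_decode k)))"
  proof (rule tannerys_theorem[where M = "\<lambda>k. 1 / (L * L) * norm (t (int_decode k))",
        THEN conjunct2, THEN conjunct2])
    show "(\<lambda>N. C N (int_decode k) * t (int_decode k)) \<longlonglongrightarrow> 1 / L * t (int_decode k)" for k
      by (intro tendsto_mult C_lim tendsto_const)
    have "norm (C N (int_decode k) * t (int_decode k)) \<le> 1 / (L * L) * norm (t (int_decode k))" for k N
      unfolding norm_mult by (intro mult_right_mono C_bound) auto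
    then show "\<forall>\<^sub>F (k, N) in sequentially \<times>\<^sub>F sequentially.
        norm (C N (int_decode k) * t (int_decode k)) \<le> 1 / (L * L) * norm (t (int_decode k))"
      by (intro always_eventually) auto
    show "summable (\<lambda>k. 1 / (L * L) * norm (t (int_decode k)))"
      using t_abs by (intro summable_mult summable_on_imp_summable)
  qed auto
  moreover have "(\<Sum>k. C N (int_decode k) * t (int_decode k)) =
      (\<Prod>j<N. (1 + x * Q ^ (2 * j + 1)) * (1 + Q ^ (2 * j + 1) / x))" for N
  proof -
    have "((\<lambda>n. C N n * t n) has_sum (\<Sum>n\<in>{- int N..int N}. C N n * t n)) {- int N..int N}"
      by (rule has_sum_finiteI) auto
    then have "((\<lambda>n. C N n * t n) has_sum (\<Sum>n\<in>{- int N..int N}. C N n * t n)) UNIV"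
      by (subst has_sum_cong_neutral[where T = "{- int N..int N}" and g = "\<lambda>n. C N n * t n"])
         (auto simp: C_def)
    then have "((\<lambda>k. C N (int_decode k) * t (int_decode k)) has_sum (\<Sum>n\<in>{- int N..int N}. C N n * t n)) UNIV"
      by (subst has_sum_reindex_bij_betw[OF bij_int_decode])
    from sums_unique[OF has_sum_imp_sums[OF this]] show ?thesis
      unfolding finite_jacobi_triple_product[OF Q(1) x] by (simp add: C_def t_def p_def)
  qed
  moreover have "(\<Sum>k. 1 / L * t (int_decode k)) = theta Q x / L"
  proof -
    have "((\<lambda>k. 1 / L * t (int_decode k)) has_sum 1 / L * theta Q x) UNIV"
      by (intro has_sum_cmult_right, subst has_sum_reindex_bij_betw[OF bij_int_decode])
         (simp add: t_def theta_has_sum Q)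
    from sums_unique[OF has_sum_imp_sums[OF this]] show ?thesis by simp
  qed
  moreover have "(\<lambda>N. \<Prod>j<N. (1 + x * Q ^ (2 * j + 1)) * (1 + Q ^ (2 * j + 1) / x)) \<longlonglongrightarrow>
      qpoch (- (x * Q)) p * qpoch (- (Q / x)) p"
  proof -
    have "(\<Prod>j<N. (1 + x * Q ^ (2 * j + 1)) * (1 + Q ^ (2 * j + 1) / x)) =
        (\<Prod>j<N. 1 - (- (x * Q)) * p ^ j) * (\<Prod>j<N. 1 - (- (Q / x)) * p ^ j)" for N
      unfolding prod.distrib[symmetric] by (simp add: p_def mult_ac flip: power_mult)
    moreover have "\<bar>p\<bar> < 1" using p by simp
    ultimately show ?thesis by (simp only:) (intro tendsto_mult qpoch_LIMSEQ)
  qed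
  ultimately have "theta Q x / L = qpoch (- (x * Q)) p * qpoch (- (Q / x)) p"
    using LIMSEQ_unique by fastforce
  then show ?thesis using L by (simp add: field_simps L_def p_def)
qed

lemma jtheta_product:
  assumes "0 < Q" "Q < 1" "x \<noteq> 0"
  shows "jtheta Q x = qpoch (Q\<^sup>2) (Q\<^sup>2) * (qpoch x (Q\<^sup>2) * qpoch (Q\<^sup>2 / x) (Q\<^sup>2))"
  using jacobi_triple_product[OF assms(1,2), of "- x / Q"] assms
  by (simp add: jtheta_def power2_eq_square)

section \<open>Theta values at powers of q\<close>

definition pair_prod :: "real \<Rightarrow> nat \<Rightarrow> real" where
  "pair_prod q r = qpoch (q ^ r) (q ^ 56) * qpoch (q ^ (56 - r)) (q ^ 56)"

lemma pair_prod_reflect: "r \<le> 56 \<Longrightarrow> pair_prod q (56 - r) = pair_prod q r"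
  by (simp add: pair_prod_def mult.commute)

lemma pair_prod_pos:
  assumes "0 < q" "q < 1" "0 < r" "r < 56"
  shows "pair_prod q r > 0"
  unfolding pair_prod_def using assms
  by (intro mult_pos_pos qpoch_pos) (auto simp: power_less_one_iff)

definition pos_theta :: "real \<Rightarrow> int \<Rightarrow> real" where
  "pos_theta q r = jtheta (q ^ 14) (q powi r) / qpoch (q ^ 28) (q ^ 28)"

definition neg_theta :: "real \<Rightarrow> int \<Rightarrow> real" where
  "neg_theta q r = jtheta (q ^ 14) (- (q powi r)) / qpoch (q ^ 28) (q ^ 28)"

lemma theta_three_term_powers:
  fixes X Y U V :: int
  assumes q: "0 < q" "q < 1"
  shows "neg_theta q (X + Y) * neg_theta q (X - Y) * (neg_theta q (U + V) * neg_theta q (U - V)) -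
         pos_theta q (X + V) * pos_theta q (X - V) * (pos_theta q (U + Y) * pos_theta q (U - Y)) =
         q powi (U - Y) * (neg_theta q (Y + V) * neg_theta q (Y - V) * (neg_theta q (X + U) * neg_theta q (X - U)))"
proof -
  have Q: "0 < q ^ 14" "q ^ 14 < 1" using q by (auto simp: power_less_one_iff)
  define c where "c = qpoch (q ^ 28) (q ^ 28)"
  have c: "c \<noteq> 0"
    using qpoch_pos[of "q ^ 28" "q ^ 28"] q by (simp add: c_def power_less_one_iff)
  have nt: "jtheta (q ^ 14) (- (q powi r)) = c * neg_theta q r"
    and pt: "jtheta (q ^ 14) (q powi r) = c * pos_theta q r" for r
    using c by (simp_all add: neg_theta_def pos_theta_def c_def)
  have "c * neg_theta q (X + Y) * (c * neg_theta q (X - Y)) * (c * neg_theta q (U + V) * (c * neg_theta q (U - V))) -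
      c * pos_theta q (X + V) * (c * pos_theta q (X - V)) * (c * pos_theta q (U + Y) * (c * pos_theta q (U - Y))) =
      q powi (U - Y) * (c * neg_theta q (Y + V) * (c * neg_theta q (Y - V)) *
        (c * neg_theta q (X + U) * (c * neg_theta q (X - U))))"
    using weierstrass_three_term[OF Q, of "- (q powi X)" "q powi Y" "q powi U" "- (q powi V)"] q
    unfolding nt[symmetric] pt[symmetric] by (simp add: power_int_add power_int_diff)
  then have "c ^ 4 * (neg_theta q (X + Y) * neg_theta q (X - Y) * (neg_theta q (U + V) * neg_theta q (U - V)) -
      pos_theta q (X + V) * pos_theta q (X - V) * (pos_theta q (U + Y) * pos_theta q (U - Y))) =
      c ^ 4 * (q powi (U - Y) * (neg_theta q (Y + V) * neg_theta q (Y - V) * (neg_theta q (X + U) * neg_theta q (X - U))))"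
    by algebra
  then show ?thesis using c by simp
qed

lemma neg_theta_reflect:
  assumes q: "0 < q" "q < 1"
  shows "neg_theta q r = q powi r * neg_theta q (- r)"
proof -
  have "0 < q ^ 14" "q ^ 14 < 1" using q by (auto simp: power_less_one_iff)
  from jtheta_inverse[OF this, of "- (q powi r)"] show ?thesis
    using q by (simp add: neg_theta_def power_int_minus divide_inverse mult_ac)
qed

lemma pos_theta_eq:
  assumes q: "0 < q" "q < 1" and r: "r \<le> 28"
  shows "pos_theta q (int r) = pair_prod q r * pair_prod q (28 - r)"
proof -
  have Q: "0 < q ^ 14" "q ^ 14 < 1" using q by (auto simp: power_less_one_iff)
  have q28: "\<bar>q ^ 28\<bar> < 1" using q by (simp add: power_less_one_iff)
  have "0 < qpoch (q ^ 28) (q ^ 28)" using q by (intro qpoch_pos) (auto simp: power_less_one_iff)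
  moreover have "q ^ 28 / q ^ r = q ^ (28 - r)" using q r by (simp add: power_diff)
  ultimately have "pos_theta q (int r) = qpoch (q ^ r) (q ^ 28) * qpoch (q ^ (28 - r)) (q ^ 28)"
    using jtheta_product[OF Q, of "q ^ r"] q by (simp add: pos_theta_def flip: power_mult)
  moreover have "r + 28 = 56 - (28 - r)" "28 - r + 28 = 56 - r" using r by auto
  ultimately show ?thesis
    using qpoch_split[OF q28, of "q ^ r"] qpoch_split[OF q28, of "q ^ (28 - r)"]
    by (simp add: pair_prod_def mult_ac flip: power_mult power_add)
qed

lemma neg_theta_eq:
  assumes q: "0 < q" "q < 1" and r: "0 < r" "r < 28"
  shows "neg_theta q (int r) = pair_prod q (2 * r) / (pair_prod q r * pair_prod q (28 - r))"
proof -
  have Q: "0 < q ^ 14" "q ^ 14 < 1" using q by (auto simp: power_less_one_iff)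
  have q28: "\<bar>q ^ 28\<bar> < 1" using q by (simp add: power_less_one_iff)
  have "0 < qpoch (q ^ 28) (q ^ 28)" using q by (intro qpoch_pos) (auto simp: power_less_one_iff)
  moreover have d: "q ^ 28 / q ^ r = q ^ (28 - r)" using q r by (simp add: power_diff)
  ultimately have p: "pos_theta q (int r) = qpoch (q ^ r) (q ^ 28) * qpoch (q ^ (28 - r)) (q ^ 28)"
    and n: "neg_theta q (int r) = qpoch (- (q ^ r)) (q ^ 28) * qpoch (- (q ^ (28 - r))) (q ^ 28)"
    using jtheta_product[OF Q, of "q ^ r"] jtheta_product[OF Q, of "- (q ^ r)"] q
    by (simp_all add: pos_theta_def neg_theta_def flip: power_mult)
  have "pos_theta q (int r) * neg_theta q (int r) =
      (qpoch (q ^ r) (q ^ 28) * qpoch (- (q ^ r)) (q ^ 28)) *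
      (qpoch (q ^ (28 - r)) (q ^ 28) * qpoch (- (q ^ (28 - r))) (q ^ 28))"
    unfolding p n by (simp add: mult_ac)
  also have "\<dots> = qpoch (q ^ (2 * r)) (q ^ 56) * qpoch (q ^ (2 * (28 - r))) (q ^ 56)"
    unfolding qpoch_mult_uminus[OF q28] power_mult[symmetric] by (simp add: mult.commute)
  also have "\<dots> = pair_prod q (2 * r)"
    by (simp add: pair_prod_def right_diff_distrib')
  finally have "pos_theta q (int r) * neg_theta q (int r) = pair_prod q (2 * r)" .
  moreover have "pos_theta q (int r) = pair_prod q r * pair_prod q (28 - r)"
    using r by (intro pos_theta_eq q) auto
  moreover have "pair_prod q r * pair_prod q (28 - r) \<noteq> 0"
    using pair_prod_pos[OF q, of r] pair_prod_pos[OF q, of "28 - r"] r by force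
  ultimately show ?thesis by (simp add: field_simps)
qed

section \<open>Generating functions of partitions\<close>

lemma finite_partitions:
  assumes "0 \<notin> S"
  shows "finite {P :: nat multiset. set_mset P \<subseteq> S \<and> sum_mset P = n}"
proof (rule finite_subset)
  show "finite (mset ` {xs. set xs \<subseteq> {..n} \<and> length xs \<le> n})"
    by (intro finite_imageI finite_lists_length_le) auto
  show "{P. set_mset P \<subseteq> S \<and> sum_mset P = n} \<subseteq> mset ` {xs. set xs \<subseteq> {..n} \<and> length xs \<le> n}"
  proof
    fix P assume P: "P \<in> {P. set_mset P \<subseteq> S \<and> sum_mset P = n}"
    obtain xs where xs: "P = mset xs" by (metis ex_mset)
    have sum: "sum_list xs = n" using P xs by (auto simp: sum_mset_sum_list)
    have pos: "0 \<notin> set xs" using P xs assms by auto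
    have "length xs \<le> sum_list xs"
      using pos by (induction xs) auto
    moreover have "x \<le> sum_list xs" if "x \<in> set xs" for x
      using that by (simp add: member_le_sum_list)
    ultimately show "P \<in> mset ` {xs. set xs \<subseteq> {..n} \<and> length xs \<le> n}"
      using xs sum by auto
  qed
qed

lemma num_partitions_mono:
  assumes "A \<subseteq> B" "0 \<notin> B"
  shows "num_partitions A n \<le> num_partitions B n"
  unfolding num_partitions_def
  using assms by (intro card_mono finite_partitions) auto

lemma num_partitions_Int_lessThan:
  assumes "n < N"
  shows "num_partitions (S \<inter> {..<N}) n = num_partitions S n"
proof -
  have "x < N" if "x \<in># P" "sum_mset P = n" for x and P :: "nat multiset"
    using multi_member_split[OF that(1)] that(2) assms by auto
  then have "{P. set_mset P \<subseteq> S \<inter> {..<N} \<and> sum_mset P = n} = {P. set_mset P \<subseteq> S \<and> sum_mset P = n}"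
    by auto
  then show ?thesis by (simp add: num_partitions_def)
qed

lemma num_partitions_insert:
  assumes "0 < a" "a \<notin> A" "0 \<notin> A"
  shows "num_partitions (insert a A) n =
    num_partitions A n + (if a \<le> n then num_partitions (insert a A) (n - a) else 0)"
proof -
  let ?X = "\<lambda>S n. {P :: nat multiset. set_mset P \<subseteq> S \<and> sum_mset P = n}"
  have eq: "?X (insert a A) n = ?X A n \<union> (if a \<le> n then add_mset a ` ?X (insert a A) (n - a) else {})"
    (is "_ = ?R")
  proof (intro set_eqI iffI)
    fix P assume P: "P \<in> ?X (insert a A) n"
    show "P \<in> ?R"
    proof (cases "a \<in># P")
      case True
      then obtain P' where "P = add_mset a P'" by (metis multi_member_split)
      then show ?thesis using P by auto
    qed (use P in auto)
  qed (auto split: if_splits)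
  have "card (?X (insert a A) n) =
      card (?X A n) + card (if a \<le> n then add_mset a ` ?X (insert a A) (n - a) else {})"
  proof (subst eq, intro card_Un_disjoint)
    show "finite (?X A n)"
      using assms by (intro finite_partitions)
    have "finite (?X (insert a A) (n - a))"
      using assms by (intro finite_partitions) auto
    then show "finite (if a \<le> n then add_mset a ` ?X (insert a A) (n - a) else {})"
      by simp
    have "a \<in># P" if "P \<in> (if a \<le> n then add_mset a ` ?X (insert a A) (n - a) else {})" for P
      using that by (auto split: if_splits)
    moreover have "a \<notin># P" if "P \<in> ?X A n" for P
      using that assms(2) by blast
    ultimately show "?X A n \<inter> (if a \<le> n then add_mset a ` ?X (insert a A) (n - a) else {}) = {}"
      by blast
  qed
  also have "card (if a \<le> n then add_mset a ` ?X (insert a A) (n - a) else {}) =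
      (if a \<le> n then card (?X (insert a A) (n - a)) else 0)"
    by (auto intro!: card_image simp: inj_on_def)
  finally show ?thesis unfolding num_partitions_def .
qed

lemma num_partitions_empty: "num_partitions {} n = (if n = 0 then 1 else 0)"
proof -
  have "{P :: nat multiset. set_mset P \<subseteq> {} \<and> sum_mset P = n} = (if n = 0 then {{#}} else {})"
    by auto
  then show ?thesis by (simp add: num_partitions_def)
qed

lemma sums_num_partitions_finite:
  fixes q :: real
  assumes "finite A" "0 \<notin> A" and q: "0 < q" "q < 1"
  shows "(\<lambda>n. num_partitions A n * q ^ n) sums (\<Prod>a\<in>A. 1 / (1 - q ^ a))"
  using assms(1,2)
proof (induction A)
  case empty
  have "(\<lambda>n. if n = 0 then 1 else 0 :: real) sums 1"
    using sums_single[of 0 "\<lambda>_. 1 :: real"] by simp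
  then show ?case
    by (subst sums_cong[where g = "\<lambda>n. if n = 0 then 1 else 0"]) (auto simp: num_partitions_empty)
next
  case (insert a A)
  define f g where "f = (\<lambda>n. num_partitions A n * q ^ n)" and "g = (\<lambda>n. num_partitions (insert a A) n * q ^ n)"
  define s where "s = (\<Prod>a\<in>A. 1 / (1 - q ^ a))"
  have a: "0 < a" using insert by auto
  have qa: "q ^ a < 1" using q a by (simp add: power_less_one_iff)
  have f: "f sums s" using insert by (simp add: f_def s_def)
  have nonneg: "0 \<le> f n" "0 \<le> g n" for n using q by (auto simp: f_def g_def)
  define g' where "g' = (\<lambda>n. if a \<le> n then g (n - a) else 0)"
  have rec: "g n = f n + q ^ a * g' n" for n
  proof (cases "a \<le> n")
    case True
    then have "q ^ n = q ^ a * q ^ (n - a)" by (simp flip: power_add)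
    then show ?thesis
      using True num_partitions_insert[of a A n] insert a
      by (simp add: f_def g_def g'_def algebra_simps)
  qed (use num_partitions_insert[of a A n] insert a in \<open>simp add: f_def g_def g'_def\<close>)
  have bound: "sum g {..<M} \<le> s / (1 - q ^ a)" for M
  proof -
    have "sum g' {..<M} = sum g' ({..<M} \<inter> {n. a \<le> n})"
      by (rule sum.mono_neutral_right) (auto simp: g'_def)
    also have "\<dots> = sum g {..<M - a}"
      by (rule sum.reindex_bij_witness[of _ "\<lambda>n. n + a" "\<lambda>n. n - a"]) (auto simp: g'_def)
    also have "\<dots> \<le> sum g {..<M}"
      by (rule sum_mono2) (auto simp: nonneg)
    finally have "sum g' {..<M} \<le> sum g {..<M}" .
    moreover have "sum g {..<M} = sum f {..<M} + q ^ a * sum g' {..<M}"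
      by (simp add: rec[abs_def] sum.distrib sum_distrib_left)
    moreover have "sum f {..<M} \<le> s"
      using sum_le_suminf[of f "{..<M}"] f nonneg(1) by (auto simp: sums_iff)
    moreover have "q ^ a * sum g' {..<M} \<le> q ^ a * sum g {..<M}"
      using q calculation(1) by (intro mult_left_mono) auto
    ultimately have "sum g {..<M} \<le> s + q ^ a * sum g {..<M}" by linarith
    then show ?thesis using qa by (simp add: field_simps)
  qed
  have "summable g"
    by (rule summableI_nonneg_bounded[OF nonneg(2) bound])
  then obtain G where G: "g sums G" by (auto simp: summable_def)
  have "g' sums G"
  proof -
    have "(\<lambda>n. g' (n + a)) sums G" using G by (simp add: g'_def)
    then have "g' sums (G + (\<Sum>i<a. g' i))" by (simp only: sums_iff_shift)
    then show ?thesis by (simp add: g'_def)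
  qed
  then have "(\<lambda>n. f n + q ^ a * g' n) sums (s + q ^ a * G)"
    by (intro sums_add sums_mult f)
  then have "G = s + q ^ a * G"
    using G sums_unique2 by (simp add: rec[abs_def])
  then have "G = 1 / (1 - q ^ a) * s" using qa by (simp add: field_simps)
  then show ?case using G insert by (simp add: g_def s_def)
qed

lemma sums_num_partitions:
  fixes q L :: real
  assumes "0 \<notin> S" and q: "0 < q" "q < 1" and "0 < k" and "L \<noteq> 0"
    and lim: "(\<lambda>j. \<Prod>a\<in>S \<inter> {..<j * k}. 1 - q ^ a) \<longlonglongrightarrow> L"
  shows "(\<lambda>n. num_partitions S n * q ^ n) sums (1 / L)"
proof -
  define F where "F = (\<lambda>N. \<Prod>a\<in>S \<inter> {..<N}. 1 / (1 - q ^ a))"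
  define f where "f = (\<lambda>n. num_partitions S n * q ^ n)"
  have F: "(\<lambda>n. num_partitions (S \<inter> {..<N}) n * q ^ n) sums F N" for N
    unfolding F_def using assms by (intro sums_num_partitions_finite) auto
  have nonneg: "0 \<le> f n" for n using q by (simp add: f_def)
  have "(\<lambda>j. F (j * k)) = (\<lambda>j. 1 / (\<Prod>a\<in>S \<inter> {..<j * k}. 1 - q ^ a))"
    by (simp add: F_def prod_dividef)
  then have F_lim: "(\<lambda>j. F (j * k)) \<longlonglongrightarrow> 1 / L"
    using tendsto_divide[OF tendsto_const lim \<open>L \<noteq> 0\<close>] by simp
  have lower: "sum f {..<N} \<le> F N" for N
  proof -
    have "sum f {..<N} = (\<Sum>n<N. num_partitions (S \<inter> {..<N}) n * q ^ n)"
      by (intro sum.cong) (auto simp: f_def num_partitions_Int_lessThan)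
    also have "\<dots> \<le> F N"
      using sum_le_suminf[OF sums_summable[OF F[of N]], of "{..<N}"] sums_unique[OF F[of N]] q by auto
    finally show ?thesis .
  qed
  have "Bseq (\<lambda>j. F (j * k))"
    by (rule convergent_imp_Bseq[OF convergentI[OF F_lim]])
  then obtain K where "\<forall>j. norm (F (j * k)) \<le> K"
    by (rule BseqE)
  then have K: "F (j * k) \<le> K" for j
    by (auto intro: abs_le_D1)
  have "sum f {..<N} \<le> K" for N
  proof -
    have "sum f {..<N} \<le> sum f {..<N * k}"
    proof (intro sum_mono2)
      have "N \<le> N * k" using \<open>0 < k\<close> by simp
      then show "{..<N} \<subseteq> {..<N * k}" by auto
    qed (auto simp: nonneg)
    then show ?thesis using lower[of "N * k"] K[of N] by linarith
  qed
  then have summable: "summable f"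
    by (rule summableI_nonneg_bounded[OF nonneg])
  have upper: "F N \<le> suminf f" for N
  proof -
    have "F N = (\<Sum>n. num_partitions (S \<inter> {..<N}) n * q ^ n)" using F sums_unique by blast
    also have "\<dots> \<le> suminf f"
      using F[of N] summable q \<open>0 \<notin> S\<close>
      by (intro suminf_le) (auto simp: f_def sums_iff intro!: mult_right_mono num_partitions_mono)
    finally show ?thesis .
  qed
  have "(\<lambda>j. sum f {..<j * k}) \<longlonglongrightarrow> suminf f"
    by (rule filterlim_compose[OF summable_LIMSEQ[OF summable]])
       (use \<open>0 < k\<close> in \<open>auto intro!: filterlim_subseq simp: strict_mono_def\<close>)
  then have "(\<lambda>j. F (j * k)) \<longlonglongrightarrow> suminf f"
    by (rule tendsto_sandwich[rotated 2, OF _ tendsto_const]) (auto simp: lower upper)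
  then have "suminf f = 1 / L" using F_lim LIMSEQ_unique by blast
  then show ?thesis using summable by (simp add: sums_iff f_def)
qed

lemma powser_eq_0_imp_coeff_eq_0:
  fixes a :: "nat \<Rightarrow> real"
  assumes "\<And>q. 0 < q \<Longrightarrow> q < 1 \<Longrightarrow> (\<lambda>n. a n * q ^ n) sums 0"
  shows "a n = 0"
proof (induction n rule: less_induct)
  case (less n)
  define f where "f = (\<lambda>x. \<Sum>k. a (k + n) * x ^ k)"
  have shift: "(\<lambda>k. a (k + n) * q ^ k) sums 0" if "0 < q" "q < 1" for q :: real
  proof -
    have "(\<lambda>k. a (k + n) * q ^ (k + n)) sums 0"
      using sums_iff_shift[of "\<lambda>k. a k * q ^ k" n 0] assms[OF that] less by simp
    from sums_mult[OF this, of "inverse (q ^ n)"] show ?thesis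
      using that by (simp add: power_add field_simps)
  qed
  have sums: "(\<lambda>k. a (k + n) * x ^ k) sums f x" if "norm x < 1 / 2" for x
    unfolding f_def using that
    by (intro summable_sums powser_inside[OF sums_summable[OF shift[of "1 / 2"]]]) auto
  have "(f \<longlongrightarrow> a (0 + n)) (at 0)"
    by (rule powser_limit_0[where s = "1 / 2", OF _ sums]) auto
  then have "(f \<longlongrightarrow> a n) (at_right 0)"
    by (simp add: filterlim_at_split)
  moreover have "(f \<longlongrightarrow> 0) (at_right 0)"
  proof (rule tendsto_eventually)
    show "eventually (\<lambda>x. f x = 0) (at_right 0)"
      using eventually_at_right_real[OF zero_less_one]
      by (rule eventually_mono) (auto simp: f_def sums_unique[OF shift, symmetric])
  qed
  ultimately show ?case
    by (rule tendsto_unique[rotated]) simp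
qed

lemma pm_residues_56:
  assumes "R \<subseteq> {1..27}"
  shows "pm_residues (int ` R) 56 = {n. n mod 56 \<in> R \<or> 56 - n mod 56 \<in> R}"
proof -
  have "(\<exists>r\<in>R. [int n = int r] (mod 56) \<or> [int n = - int r] (mod 56)) \<longleftrightarrow>
      (\<exists>r\<in>R. n mod 56 = r \<or> 56 - n mod 56 = r)" for n
  proof (intro bex_cong refl)
    fix r assume "r \<in> R"
    then have "1 \<le> r" "r \<le> 27" using assms by auto
    then have mods: "int n mod 56 = int (n mod 56)" "int r mod 56 = int r" "(- int r) mod 56 = int (56 - r)"
      by (simp_all add: zmod_int zmod_zminus1_eq_if)
    have "n mod 56 < 56" by simp
    with \<open>r \<le> 27\<close> show "([int n = int r] (mod 56) \<or> [int n = - int r] (mod 56)) \<longleftrightarrow> (n mod 56 = r \<or> 56 - n mod 56 = r)"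
      using mods by (auto simp: cong_def)
  qed
  moreover have "n > 0" if "n mod 56 \<in> R \<or> 56 - n mod 56 \<in> R" for n
    using that assms by (cases "n = 0") auto
  ultimately show ?thesis
    by (auto simp: pm_residues_def)
qed

lemma prod_pm_residues_56:
  fixes q :: real
  assumes R: "R \<subseteq> {1..27}"
  shows "(\<Prod>a\<in>pm_residues (int ` R) 56 \<inter> {..<j * 56}. 1 - q ^ a) =
    (\<Prod>r\<in>R. (\<Prod>i<j. 1 - q ^ r * (q ^ 56) ^ i) * (\<Prod>i<j. 1 - q ^ (56 - r) * (q ^ 56) ^ i))"
proof -
  have [simp]: "finite R" using R finite_subset by blast
  let ?f = "\<lambda>(r, i). r + 56 * i" and ?g = "\<lambda>(r, i). 56 - r + 56 * i"
  have RD: "1 \<le> r" "r \<le> 27" if "r \<in> R" for r using R that by auto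
  have mod_eq: "(x + 56 * i) mod 56 = x" if "x < 56" for x i :: nat
    using that by simp
  have uniq: "x = y \<and> i = k" if "x < 56" "y < 56" and eq: "x + 56 * i = y + 56 * k" for x y i k :: nat
  proof -
    have "x = y"
      using mod_eq[OF that(1), of i] mod_eq[OF that(2), of k] unfolding eq by simp
    then show ?thesis using eq by simp
  qed
  have "pm_residues (int ` R) 56 \<inter> {..<j * 56} = ?f ` (R \<times> {..<j}) \<union> ?g ` (R \<times> {..<j})" (is "?L = _")
  proof (intro set_eqI iffI)
    fix n assume n: "n \<in> ?L"
    then have "n div 56 < j" by (simp add: less_mult_imp_div_less)
    moreover have "n = ?f (n mod 56, n div 56)" "n = ?g (56 - n mod 56, n div 56)"
      by auto
    ultimately show "n \<in> ?f ` (R \<times> {..<j}) \<union> ?g ` (R \<times> {..<j})"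
      using n unfolding pm_residues_56[OF R] by (blast intro: SigmaI)
  next
    fix n assume "n \<in> ?f ` (R \<times> {..<j}) \<union> ?g ` (R \<times> {..<j})"
    then obtain r i where r: "r \<in> R" "i < j" and n: "n = r + 56 * i \<or> n = 56 - r + 56 * i" by auto
    have "n mod 56 = r \<or> n mod 56 = 56 - r"
      using n RD[OF r(1)] mod_eq[of r i] mod_eq[of "56 - r" i] by auto
    then have "n mod 56 = r \<or> 56 - n mod 56 = r"
      using RD[OF r(1)] by auto
    moreover have "n < j * 56" using n r(2) RD[OF r(1)] by auto
    ultimately show "n \<in> ?L"
      using r(1) unfolding pm_residues_56[OF R] by auto
  qed
  moreover have "?f ` (R \<times> {..<j}) \<inter> ?g ` (R \<times> {..<j}) = {}"
  proof -
    have "r + 56 * i \<noteq> 56 - s + 56 * k" if "r \<in> R" "s \<in> R" for r s i k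
      using RD[OF that(1)] RD[OF that(2)] uniq[of r "56 - s" i k] by auto
    then show ?thesis by auto
  qed
  moreover have "inj_on ?f (R \<times> {..<j})" "inj_on ?g (R \<times> {..<j})"
  proof -
    have "r = s \<and> i = k" if "r \<in> R" "s \<in> R" "r + 56 * i = s + 56 * k \<or> 56 - r + 56 * i = 56 - s + 56 * k" for r s i k
      using RD[OF that(1)] RD[OF that(2)] that(3) uniq[of r s i k] uniq[of "56 - r" "56 - s" i k] by auto
    then show "inj_on ?f (R \<times> {..<j})" "inj_on ?g (R \<times> {..<j})"
      by (auto intro!: inj_onI)
  qed
  ultimately have "(\<Prod>a\<in>pm_residues (int ` R) 56 \<inter> {..<j * 56}. 1 - q ^ a) =
      (\<Prod>(r, i)\<in>R \<times> {..<j}. 1 - q ^ (r + 56 * i)) * (\<Prod>(r, i)\<in>R \<times> {..<j}. 1 - q ^ (56 - r + 56 * i))"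
    by (simp add: prod.union_disjoint prod.reindex case_prod_unfold)
  then show ?thesis
    by (simp add: prod.distrib power_add power_mult flip: prod.cartesian_product)
qed

lemma sums_num_partitions_pm_residues:
  fixes q :: real
  assumes R: "R \<subseteq> {1..27}" and q: "0 < q" "q < 1"
  shows "(\<lambda>n. num_partitions (pm_residues (int ` R) 56) n * q ^ n) sums (1 / (\<Prod>r\<in>R. pair_prod q r))"
proof (rule sums_num_partitions[where k = 56])
  have "pair_prod q r \<noteq> 0" if "r \<in> R" for r
    using pair_prod_pos[OF q, of r] R that by force
  then show "(\<Prod>r\<in>R. pair_prod q r) \<noteq> 0"
    using finite_subset[OF R] by simp
  have "\<bar>q ^ 56\<bar> < 1" using q by (simp add: power_less_one_iff)
  then show "(\<lambda>j. \<Prod>a\<in>pm_residues (int ` R) 56 \<inter> {..<j * 56}. 1 - q ^ a) \<longlonglongrightarrow> (\<Prod>r\<in>R. pair_prod q r)"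
    unfolding prod_pm_residues_56[OF R] pair_prod_def
    by (intro tendsto_prod tendsto_mult qpoch_LIMSEQ)
qed (use q in \<open>auto simp: pm_residues_def\<close>)

lemma num_partitions_eq_of_pair_prod:
  assumes R: "R \<subseteq> {1..27}" "R' \<subseteq> {1..27}"
    and eq: "\<And>q. 0 < q \<Longrightarrow> q < 1 \<Longrightarrow>
      1 / (\<Prod>r\<in>R. pair_prod q r) - q ^ k * (1 / (\<Prod>r\<in>R'. pair_prod q r)) = q ^ m"
    and n: "k \<le> n" "n \<noteq> m"
  shows "num_partitions (pm_residues (int ` R) 56) n = num_partitions (pm_residues (int ` R') 56) (n - k)"
proof -
  let ?S = "pm_residues (int ` R) 56" and ?T = "pm_residues (int ` R') 56"
  let ?a = "\<lambda>n. real (num_partitions ?S n) - (if k \<le> n then real (num_partitions ?T (n - k)) else 0) -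
    (if n = m then 1 else 0)"
  have "(\<lambda>n. ?a n * q ^ n) sums 0" if q: "0 < q" "q < 1" for q :: real
  proof -
    let ?t = "\<lambda>n. if k \<le> n then real (num_partitions ?T (n - k)) * q ^ n else 0"
    have "(\<lambda>n. q ^ k * (num_partitions ?T n * q ^ n)) sums (q ^ k * (1 / (\<Prod>r\<in>R'. pair_prod q r)))"
      by (intro sums_mult sums_num_partitions_pm_residues R q)
    then have "(\<lambda>n. ?t (n + k)) sums (q ^ k * (1 / (\<Prod>r\<in>R'. pair_prod q r)))"
      by (simp add: power_add mult_ac)
    then have "?t sums (q ^ k * (1 / (\<Prod>r\<in>R'. pair_prod q r)) + (\<Sum>i<k. ?t i))"
      by (rule iffD1[OF sums_iff_shift[of ?t k]])
    then have t: "?t sums (q ^ k * (1 / (\<Prod>r\<in>R'. pair_prod q r)))"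
      by simp
    have "(\<lambda>n. if n = m then q ^ n else 0) sums q ^ m"
      by (rule sums_single)
    from sums_diff[OF sums_diff[OF sums_num_partitions_pm_residues[OF R(1) q] t] this]
    have "(\<lambda>n. num_partitions ?S n * q ^ n - ?t n - (if n = m then q ^ n else 0)) sums 0"
      using eq[OF q] by simp
    then show ?thesis
      by (rule sums_cong[THEN iffD1, rotated]) (simp add: algebra_simps)
  qed
  from powser_eq_0_imp_coeff_eq_0[of ?a n, OF this] n show ?thesis by simp
qed

section \<open>The six identities\<close>

lemma neg_theta_numeral:
  assumes "0 < q" "q < 1"
  shows "neg_theta q 1 = pair_prod q 2 / (pair_prod q 1 * pair_prod q 27)"
    and "numeral k < (28::nat) \<Longrightarrow> neg_theta q (numeral k) =
      pair_prod q (2 * numeral k) / (pair_prod q (numeral k) * pair_prod q (28 - numeral k))"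
  using neg_theta_eq[OF assms, of 1] neg_theta_eq[OF assms, of "numeral k"] by simp_all

lemma pos_theta_numeral:
  assumes "0 < q" "q < 1"
  shows "pos_theta q 1 = pair_prod q 1 * pair_prod q 27"
    and "numeral k < (28::nat) \<Longrightarrow> pos_theta q (numeral k) = pair_prod q (numeral k) * pair_prod q (28 - numeral k)"
  using pos_theta_eq[OF assms, of 1] pos_theta_eq[OF assms, of "numeral k"] by simp_all

lemma pair_prod_reflect_numeral:
  "28 < (numeral k :: nat) \<Longrightarrow> numeral k \<le> (56::nat) \<Longrightarrow> pair_prod q (numeral k) = pair_prod q (56 - numeral k)"
  using pair_prod_reflect[of "numeral k" q] by simp

lemma quotient_identity:
  fixes a b c :: real
  assumes "a - s * b = t * c" "c \<noteq> 0" "x = a / c" "y = b / c"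
  shows "x - s * y = t"
proof -
  have "x - s * y = (a - s * b) / c" using assms(3,4) by (simp add: diff_divide_distrib)
  then show ?thesis using assms(1,2) by simp
qed

context
  fixes q :: real
  assumes q: "0 < q" "q < 1"
begin

lemma pair_prod_nonzero: "0 < r \<Longrightarrow> r < 56 \<Longrightarrow> pair_prod q r \<noteq> 0"
  using pair_prod_pos[OF q, of r] by simp

lemmas theta_simps = neg_theta_numeral[OF q] pos_theta_numeral[OF q] pair_prod_reflect_numeral pair_prod_nonzero

text \<open>
  The exponents in the instances of the three-term relation come from a search for a relation
  whose quotients have the prescribed factors.
\<close>

lemma pair_prod_identity_i:
  "1 / (\<Prod>r\<in>{1, 3, 4, 5, 7, 18, 21, 22, 23, 24, 25, 27}. pair_prod q r) -
   q ^ 1 * (1 / (\<Prod>r\<in>{1, 2, 3, 7, 11, 17, 20, 21, 24, 25, 26, 27}. pair_prod q r)) = q ^ 0"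
proof (rule quotient_identity)
  show "neg_theta q 10 * neg_theta q 4 * (neg_theta q 5 * neg_theta q 3) -
      q ^ 1 * (neg_theta q 4 * neg_theta q 2 * (neg_theta q 11 * neg_theta q 3)) =
      q ^ 0 * (pos_theta q 8 * pos_theta q 6 * (pos_theta q 7 * pos_theta q 1))"
    using theta_three_term_powers[OF q, of 7 3 4 1, simplified]
    by algebra
  show "pos_theta q 8 * pos_theta q 6 * (pos_theta q 7 * pos_theta q 1) \<noteq> 0"
    by (simp add: theta_simps)
  show "1 / (\<Prod>r\<in>{1, 3, 4, 5, 7, 18, 21, 22, 23, 24, 25, 27}. pair_prod q r) =
      (neg_theta q 10 * neg_theta q 4 * (neg_theta q 5 * neg_theta q 3)) /
      (pos_theta q 8 * pos_theta q 6 * (pos_theta q 7 * pos_theta q 1))"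
    by (simp add: theta_simps field_simps)
  show "1 / (\<Prod>r\<in>{1, 2, 3, 7, 11, 17, 20, 21, 24, 25, 26, 27}. pair_prod q r) =
      (neg_theta q 4 * neg_theta q 2 * (neg_theta q 11 * neg_theta q 3)) /
      (pos_theta q 8 * pos_theta q 6 * (pos_theta q 7 * pos_theta q 1))"
    by (simp add: theta_simps field_simps)
qed

lemma pair_prod_identity_ii:
  "1 / (\<Prod>r\<in>{2, 3, 7, 9, 10, 12, 13, 15, 16, 19, 21, 25}. pair_prod q r) -
   q ^ 0 * (1 / (\<Prod>r\<in>{3, 4, 5, 6, 7, 9, 16, 19, 21, 22, 23, 25}. pair_prod q r)) = q ^ 2"
proof (rule quotient_identity)
  show "neg_theta q 13 * neg_theta q 9 * (neg_theta q 12 * neg_theta q 2) -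
      q ^ 0 * (neg_theta q 9 * neg_theta q 5 * (neg_theta q 16 * neg_theta q 6)) =
      q ^ 2 * (pos_theta q 18 * pos_theta q 4 * (pos_theta q 7 * pos_theta q 3))"
    using theta_three_term_powers[OF q, of 11 2 5 7, simplified] neg_theta_reflect[OF q, of 2, simplified] neg_theta_reflect[OF q, of 5, simplified]
    by algebra
  show "pos_theta q 18 * pos_theta q 4 * (pos_theta q 7 * pos_theta q 3) \<noteq> 0"
    by (simp add: theta_simps)
  show "1 / (\<Prod>r\<in>{2, 3, 7, 9, 10, 12, 13, 15, 16, 19, 21, 25}. pair_prod q r) =
      (neg_theta q 13 * neg_theta q 9 * (neg_theta q 12 * neg_theta q 2)) /
      (pos_theta q 18 * pos_theta q 4 * (pos_theta q 7 * pos_theta q 3))"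
    by (simp add: theta_simps field_simps)
  show "1 / (\<Prod>r\<in>{3, 4, 5, 6, 7, 9, 16, 19, 21, 22, 23, 25}. pair_prod q r) =
      (neg_theta q 9 * neg_theta q 5 * (neg_theta q 16 * neg_theta q 6)) /
      (pos_theta q 18 * pos_theta q 4 * (pos_theta q 7 * pos_theta q 3))"
    by (simp add: theta_simps field_simps)
qed

lemma pair_prod_identity_iii:
  "1 / (\<Prod>r\<in>{1, 5, 7, 8, 10, 12, 13, 15, 18, 21, 23, 27}. pair_prod q r) -
   q ^ 0 * (1 / (\<Prod>r\<in>{2, 3, 5, 7, 8, 13, 15, 20, 21, 22, 23, 25}. pair_prod q r)) = q ^ 1"
proof (rule quotient_identity)
  show "neg_theta q 10 * neg_theta q 8 * (neg_theta q 13 * neg_theta q 1) -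
      q ^ 0 * (neg_theta q 8 * neg_theta q 6 * (neg_theta q 15 * neg_theta q 3)) =
      q ^ 1 * (pos_theta q 16 * pos_theta q 2 * (pos_theta q 7 * pos_theta q 5))"
    using theta_three_term_powers[OF q, of 9 1 6 7, simplified] neg_theta_reflect[OF q, of 1, simplified] neg_theta_reflect[OF q, of 6, simplified]
    by algebra
  show "pos_theta q 16 * pos_theta q 2 * (pos_theta q 7 * pos_theta q 5) \<noteq> 0"
    by (simp add: theta_simps)
  show "1 / (\<Prod>r\<in>{1, 5, 7, 8, 10, 12, 13, 15, 18, 21, 23, 27}. pair_prod q r) =
      (neg_theta q 10 * neg_theta q 8 * (neg_theta q 13 * neg_theta q 1)) /
      (pos_theta q 16 * pos_theta q 2 * (pos_theta q 7 * pos_theta q 5))"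
    by (simp add: theta_simps field_simps)
  show "1 / (\<Prod>r\<in>{2, 3, 5, 7, 8, 13, 15, 20, 21, 22, 23, 25}. pair_prod q r) =
      (neg_theta q 8 * neg_theta q 6 * (neg_theta q 15 * neg_theta q 3)) /
      (pos_theta q 16 * pos_theta q 2 * (pos_theta q 7 * pos_theta q 5))"
    by (simp add: theta_simps field_simps)
qed

lemma pair_prod_identity_iv:
  "1 / (\<Prod>r\<in>{1, 7, 8, 9, 10, 12, 13, 15, 18, 19, 21, 27}. pair_prod q r) -
   q ^ 1 * (1 / (\<Prod>r\<in>{1, 6, 7, 8, 9, 11, 17, 19, 20, 21, 26, 27}. pair_prod q r)) = q ^ 0"
proof (rule quotient_identity)
  show "neg_theta q 10 * neg_theta q 8 * (neg_theta q 15 * neg_theta q 1) -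
      q ^ 1 * (neg_theta q 8 * neg_theta q 6 * (neg_theta q 17 * neg_theta q 1)) =
      q ^ 0 * (pos_theta q 16 * pos_theta q 2 * (pos_theta q 9 * pos_theta q 7))"
    using theta_three_term_powers[OF q, of 9 1 8 7, simplified] neg_theta_reflect[OF q, of 6, simplified]
    by algebra
  show "pos_theta q 16 * pos_theta q 2 * (pos_theta q 9 * pos_theta q 7) \<noteq> 0"
    by (simp add: theta_simps)
  show "1 / (\<Prod>r\<in>{1, 7, 8, 9, 10, 12, 13, 15, 18, 19, 21, 27}. pair_prod q r) =
      (neg_theta q 10 * neg_theta q 8 * (neg_theta q 15 * neg_theta q 1)) /
      (pos_theta q 16 * pos_theta q 2 * (pos_theta q 9 * pos_theta q 7))"
    by (simp add: theta_simps field_simps)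
  show "1 / (\<Prod>r\<in>{1, 6, 7, 8, 9, 11, 17, 19, 20, 21, 26, 27}. pair_prod q r) =
      (neg_theta q 8 * neg_theta q 6 * (neg_theta q 17 * neg_theta q 1)) /
      (pos_theta q 16 * pos_theta q 2 * (pos_theta q 9 * pos_theta q 7))"
    by (simp add: theta_simps field_simps)
qed

lemma pair_prod_identity_v:
  "1 / (\<Prod>r\<in>{4, 5, 6, 7, 9, 11, 16, 17, 19, 21, 22, 23}. pair_prod q r) -
   q ^ 4 * (1 / (\<Prod>r\<in>{1, 5, 7, 11, 12, 16, 17, 18, 21, 23, 26, 27}. pair_prod q r)) = q ^ 0"
proof (rule quotient_identity)
  show "neg_theta q 12 * neg_theta q 6 * (neg_theta q 9 * neg_theta q 5) -
      q ^ 4 * (neg_theta q 5 * neg_theta q 1 * (neg_theta q 16 * neg_theta q 2)) =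
      q ^ 0 * (pos_theta q 11 * pos_theta q 7 * (pos_theta q 10 * pos_theta q 4))"
    using theta_three_term_powers[OF q, of 9 3 7 2, simplified]
    by algebra
  show "pos_theta q 11 * pos_theta q 7 * (pos_theta q 10 * pos_theta q 4) \<noteq> 0"
    by (simp add: theta_simps)
  show "1 / (\<Prod>r\<in>{4, 5, 6, 7, 9, 11, 16, 17, 19, 21, 22, 23}. pair_prod q r) =
      (neg_theta q 12 * neg_theta q 6 * (neg_theta q 9 * neg_theta q 5)) /
      (pos_theta q 11 * pos_theta q 7 * (pos_theta q 10 * pos_theta q 4))"
    by (simp add: theta_simps field_simps)
  show "1 / (\<Prod>r\<in>{1, 5, 7, 11, 12, 16, 17, 18, 21, 23, 26, 27}. pair_prod q r) =
      (neg_theta q 5 * neg_theta q 1 * (neg_theta q 16 * neg_theta q 2)) /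
      (pos_theta q 11 * pos_theta q 7 * (pos_theta q 10 * pos_theta q 4))"
    by (simp add: theta_simps field_simps)
qed

lemma pair_prod_identity_vi:
  "1 / (\<Prod>r\<in>{4, 6, 7, 9, 10, 11, 13, 15, 17, 19, 21, 24}. pair_prod q r) -
   q ^ 4 * (1 / (\<Prod>r\<in>{2, 3, 7, 11, 13, 15, 17, 20, 21, 24, 25, 26}. pair_prod q r)) = q ^ 0"
proof (rule quotient_identity)
  show "neg_theta q 11 * neg_theta q 9 * (neg_theta q 10 * neg_theta q 4) -
      q ^ 4 * (neg_theta q 4 * neg_theta q 2 * (neg_theta q 17 * neg_theta q 3)) =
      q ^ 0 * (pos_theta q 13 * pos_theta q 7 * (pos_theta q 8 * pos_theta q 6))"
    using theta_three_term_powers[OF q, of 10 1 7 3, simplified] neg_theta_reflect[OF q, of 2, simplified]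
    by algebra
  show "pos_theta q 13 * pos_theta q 7 * (pos_theta q 8 * pos_theta q 6) \<noteq> 0"
    by (simp add: theta_simps)
  show "1 / (\<Prod>r\<in>{4, 6, 7, 9, 10, 11, 13, 15, 17, 19, 21, 24}. pair_prod q r) =
      (neg_theta q 11 * neg_theta q 9 * (neg_theta q 10 * neg_theta q 4)) /
      (pos_theta q 13 * pos_theta q 7 * (pos_theta q 8 * pos_theta q 6))"
    by (simp add: theta_simps field_simps)
  show "1 / (\<Prod>r\<in>{2, 3, 7, 11, 13, 15, 17, 20, 21, 24, 25, 26}. pair_prod q r) =
      (neg_theta q 4 * neg_theta q 2 * (neg_theta q 17 * neg_theta q 3)) /
      (pos_theta q 13 * pos_theta q 7 * (pos_theta q 8 * pos_theta q 6))"
    by (simp add: theta_simps field_simps)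
qed

end

theorem theorem11p1:
  shows "(let S = pm_residues {1, 3, 4, 5, 7, 18, 21, 22, 23, 24, 25, 27} 56;
         T = pm_residues {1, 2, 3, 7, 11, 17, 20, 21, 24, 25, 26, 27} 56
     in \<forall>n\<ge>1. num_partitions S n = num_partitions T (n - 1))
   \<and> (let S = pm_residues {2, 3, 7, 9, 10, 12, 13, 15, 16, 19, 21, 25} 56;
         T = pm_residues {3, 4, 5, 6, 7, 9, 16, 19, 21, 22, 23, 25} 56
     in \<forall>n. n \<noteq> 2 \<longrightarrow> num_partitions S n = num_partitions T n)
   \<and> (let S = pm_residues {2, 3, 5, 7, 8, 13, 15, 20, 21, 22, 23, 25} 56;
         T = pm_residues {1, 5, 7, 8, 10, 12, 13, 15, 18, 21, 23, 27} 56
     in \<forall>n. n \<noteq> 1 \<longrightarrow> num_partitions S n = num_partitions T n)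
   \<and> (let S = pm_residues {1, 7, 8, 9, 10, 12, 13, 15, 18, 19, 21, 27} 56;
         T = pm_residues {1, 6, 7, 8, 9, 11, 17, 19, 20, 21, 26, 27} 56
     in \<forall>n\<ge>1. num_partitions S n = num_partitions T (n - 1))
   \<and> (let S = pm_residues {4, 5, 6, 7, 9, 11, 16, 17, 19, 21, 22, 23} 56;
         T = pm_residues {1, 5, 7, 11, 12, 16, 17, 18, 21, 23, 26, 27} 56
     in \<forall>n\<ge>4. num_partitions S n = num_partitions T (n - 4))
   \<and> (let S = pm_residues {4, 6, 7, 9, 10, 11, 13, 15, 17, 19, 21, 24} 56;
         T = pm_residues {2, 3, 7, 11, 13, 15, 17, 20, 21, 24, 25, 26} 56
     in \<forall>n\<ge>4. num_partitions S n = num_partitions T (n - 4))"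
proof -
  have i: "num_partitions (pm_residues {1, 3, 4, 5, 7, 18, 21, 22, 23, 24, 25, 27} 56) n =
      num_partitions (pm_residues {1, 2, 3, 7, 11, 17, 20, 21, 24, 25, 26, 27} 56) (n - 1)" if "1 \<le> n" for n
    using num_partitions_eq_of_pair_prod[OF _ _ pair_prod_identity_i, of n] that by simp
  have ii: "num_partitions (pm_residues {2, 3, 7, 9, 10, 12, 13, 15, 16, 19, 21, 25} 56) n =
      num_partitions (pm_residues {3, 4, 5, 6, 7, 9, 16, 19, 21, 22, 23, 25} 56) n" if "n \<noteq> 2" for n
    using num_partitions_eq_of_pair_prod[OF _ _ pair_prod_identity_ii, of n] that by simp
  have iii: "num_partitions (pm_residues {1, 5, 7, 8, 10, 12, 13, 15, 18, 21, 23, 27} 56) n =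
      num_partitions (pm_residues {2, 3, 5, 7, 8, 13, 15, 20, 21, 22, 23, 25} 56) n" if "n \<noteq> 1" for n
    using num_partitions_eq_of_pair_prod[OF _ _ pair_prod_identity_iii, of n] that by simp
  have iv: "num_partitions (pm_residues {1, 7, 8, 9, 10, 12, 13, 15, 18, 19, 21, 27} 56) n =
      num_partitions (pm_residues {1, 6, 7, 8, 9, 11, 17, 19, 20, 21, 26, 27} 56) (n - 1)" if "1 \<le> n" for n
    using num_partitions_eq_of_pair_prod[OF _ _ pair_prod_identity_iv, of n] that by simp
  have v: "num_partitions (pm_residues {4, 5, 6, 7, 9, 11, 16, 17, 19, 21, 22, 23} 56) n =
      num_partitions (pm_residues {1, 5, 7, 11, 12, 16, 17, 18, 21, 23, 26, 27} 56) (n - 4)" if "4 \<le> n" for n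
    using num_partitions_eq_of_pair_prod[OF _ _ pair_prod_identity_v, of n] that by simp
  have vi: "num_partitions (pm_residues {4, 6, 7, 9, 10, 11, 13, 15, 17, 19, 21, 24} 56) n =
      num_partitions (pm_residues {2, 3, 7, 11, 13, 15, 17, 20, 21, 24, 25, 26} 56) (n - 4)" if "4 \<le> n" for n
    using num_partitions_eq_of_pair_prod[OF _ _ pair_prod_identity_vi, of n] that by simp
  show ?thesis
    unfolding Let_def by (intro conjI allI impI i ii iii[symmetric] iv v vi)
qed

end
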